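(* Let $n$ be a positive integer and let $\alpha,\beta$ be real numbers with $n+\alpha+\beta>0$, $n+\alpha>0$, $n+\beta>0$. Put $$x=\alpha^2-1,\qquad y=\beta^2-1,\qquad z=(\alpha+\beta+2n)(\alpha+\beta+2n+2),$$ $$D=12\left(3x^2+3y^2+z^2-6xy-4xz-4yz\right).$$ If $|\alpha|>1$, $|\beta|<1$ and $D<0$, then all the zeros of the Jacobi polynomial $P_n^{(\alpha,\beta)}$ on the interval $(-1,1)$ are convex.
   Context: $P_n^{(\alpha,\beta)}$ is the Jacobi polynomial, defined for all real $\alpha,\beta$ by $$P_n^{(\alpha,\beta)}(t)=\sum_{s=0}^{n}\binom{n+\alpha}{n-s}\binom{n+\beta}{s}\left(\frac{t-1}{2}\right)^{s}\left(\frac{t+1}{2}\right)^{n-s};$$ it satisfies $(1-t^2)x''(t)+(\beta-\alpha-(\alpha+\beta+2)t)x'(t)+n(n+\alpha+\beta+1)x(t)=0$ (here $x(t)$ denotes the unknown function). For $\alpha,\beta>-1$ these polynomials are orthogonal on $(-1,1)$ with weight $(1-t)^{\alpha}(1+t)^{\beta}$. Convexity convention: the zeros of a function on an interval $(a,b)$, listed in increasing order as $x_1<x_2<\dots$ (only those lying in $(a,b)$), are called convex on $(a,b)$ if $x_{k+2}-x_{k+1}>x_{k+1}-x_k$ for every three consecutive zeros $x_k<x_{k+1}<x_{k+2}$ in $(a,b)$. *)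

theory Defs
  imports "HOL-Analysis.Analysis"
begin

definition jacobi_P :: "nat \<Rightarrow> real \<Rightarrow> real \<Rightarrow> real \<Rightarrow> real" where
  "jacobi_P n \<alpha> \<beta> t =
     (\<Sum>s=0..n. ((real n + \<alpha>) gchoose (n - s)) * ((real n + \<beta>) gchoose s)
                * ((t - 1) / 2) ^ s * ((t + 1) / 2) ^ (n - s))"

definition zeros_on :: "(real \<Rightarrow> real) \<Rightarrow> real \<Rightarrow> real \<Rightarrow> real set" where
  "zeros_on f a b = {t \<in> {a<..<b}. f t = 0}"

definition consecutive_zeros_on :: "(real \<Rightarrow> real) \<Rightarrow> real \<Rightarrow> real \<Rightarrow> real \<Rightarrow> real \<Rightarrow> bool" where
  "consecutive_zeros_on f a b u v \<longleftrightarrow>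
     u \<in> zeros_on f a b \<and> v \<in> zeros_on f a b \<and> u < v \<and> zeros_on f a b \<inter> {u<..<v} = {}"

text \<open>Only zeros inside the open interval count, and they are counted without multiplicity.
  With fewer than three zeros the condition holds vacuously.\<close>

definition zeros_convex_on :: "(real \<Rightarrow> real) \<Rightarrow> real \<Rightarrow> real \<Rightarrow> bool" where
  "zeros_convex_on f a b \<longleftrightarrow>
     (\<forall>u v w. consecutive_zeros_on f a b u v \<longrightarrow> consecutive_zeros_on f a b v w \<longrightarrow> w - v > v - u)"

end

theory Submission
  imports Defs
begin

text \<open>
  The idea is Sturm's: if \<open>f'' = - Q f\<close> with \<open>Q\<close> strictly decreasing, then \<open>f\<close> oscillates ever more
  slowly, so the gaps between its zeros grow.  To compare two neighbouring gaps, reflect \<open>f\<close> in their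
  common endpoint; to the right of it the reflected function solves an equation with a strictly
  larger coefficient, and the Wronskian of the two shows that it vanishes first (\<open>sturm_comparison\<close>,
  \<open>zeros_convex_of_decreasing_coefficient\<close>).

  The Jacobi polynomial satisfies a second-order equation with a first-order term
  (\<open>jacobi_differential_equation\<close>).  Multiplication by \<open>(1-t)\<^bsup>(\<alpha>+1)/2\<^esup> (1+t)\<^bsup>(\<beta>+1)/2\<^esup>\<close> removes that
  term without moving any zero in \<open>(-1,1)\<close> (\<open>liouville_normal_form\<close>), and leaves
  \<open>4 Q(t) = - x / (1-t)\<^sup>2 - y / (1+t)\<^sup>2 + (z-x-y) / (1-t\<^sup>2)\<close>.
  Up to the positive factor \<open>2 / (1-t\<^sup>2)\<^sup>3\<close>, the derivative of \<open>4 Q\<close> is a cubic \<open>p\<close>, and \<open>D\<close> is exactly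
  the discriminant of the quadratic \<open>p'\<close>.  Hence \<open>D < 0\<close> makes \<open>p\<close> monotone, so its values on
  \<open>[-1,1]\<close> lie between \<open>p(-1) = 8 y\<close> and \<open>p(1) = - 8 x\<close>.  Both are negative because
  \<open>\<bar>\<beta>\<bar> < 1 < \<bar>\<alpha>\<bar>\<close>, so \<open>Q\<close> decreases strictly.
\<close>

section \<open>Sturm comparison and the spacing of zeros\<close>

lemma nonvanishing_same_sign:
  fixes f :: "real \<Rightarrow> real"
  assumes cont: "continuous_on {a<..<b} f"
    and nz: "\<And>t. t \<in> {a<..<b} \<Longrightarrow> f t \<noteq> 0"
    and s: "s \<in> {a<..<b}" and t: "t \<in> {a<..<b}"
  shows "f s * f t > 0"
proof (rule ccontr)
  assume neg: "\<not> f s * f t > 0"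
  have "connected (f ` {a<..<b})"
    using cont by (intro connected_continuous_image) auto
  moreover have "f s \<in> f ` {a<..<b}" "f t \<in> f ` {a<..<b}"
    using s t by auto
  moreover have "f s \<le> 0 \<and> 0 \<le> f t \<or> f t \<le> 0 \<and> 0 \<le> f s"
    using neg by (auto simp: zero_less_mult_iff not_less)
  ultimately have "0 \<in> f ` {a<..<b}"
    by (meson connectedD_interval)
  then show False
    using nz by auto
qed

text \<open>The Wronskian \<open>f' g - f g'\<close> has derivative \<open>(R - Q) f g\<close>.  For positive \<open>f\<close> and \<open>g\<close> it would
  therefore increase from its value \<open>0\<close> at \<open>a\<close>, but at \<open>b\<close> it equals \<open>f'(b) g(b) \<le> 0\<close>.\<close>

lemma sturm_comparison_pos:
  fixes f g :: "real \<Rightarrow> real"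
  assumes ab: "a < b"
    and f: "\<And>t. t \<in> {a..b} \<Longrightarrow> (f has_real_derivative f' t) (at t)"
           "\<And>t. t \<in> {a..b} \<Longrightarrow> (f' has_real_derivative - Q t * f t) (at t)"
    and g: "\<And>t. t \<in> {a..b} \<Longrightarrow> (g has_real_derivative g' t) (at t)"
           "\<And>t. t \<in> {a..b} \<Longrightarrow> (g' has_real_derivative - R t * g t) (at t)"
    and QR: "\<And>t. t \<in> {a<..<b} \<Longrightarrow> Q t < R t"
    and fpos: "\<And>t. t \<in> {a<..<b} \<Longrightarrow> f t > 0"
    and gpos: "\<And>t. t \<in> {a<..<b} \<Longrightarrow> g t > 0"
    and zeros: "f a = 0" "f b = 0" "g a = 0"
  shows False
proof -
  define W where "W t = f' t * g t - f t * g' t" for t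
  have "(W has_real_derivative (R t - Q t) * (f t * g t)) (at t)" if "t \<in> {a..b}" for t
    unfolding W_def using that
    by (auto intro!: derivative_eq_intros f g simp: algebra_simps)
  then obtain c where c: "c \<in> {a<..<b}" "W b - W a = (b - a) * ((R c - Q c) * (f c * g c))"
    using MVT2[OF ab, of W "\<lambda>t. (R t - Q t) * (f t * g t)"] by auto
  have "W b - W a > 0"
    using c QR fpos gpos ab by simp
  then have pos: "f' b * g b > 0"
    using zeros by (simp add: W_def)
  have near: "eventually (\<lambda>t. t \<in> {a<..<b}) (at_left b)"
    using ab by (rule eventually_at_left_real)
  have "isCont g b"
    using g(1)[of b] ab by (auto intro: DERIV_isCont)
  then have "(g \<longlongrightarrow> g b) (at_left b)"
    unfolding isCont_def by (rule tendsto_mono[OF at_le, rotated]) simp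
  then have "g b \<ge> 0"
    by (rule tendsto_lowerbound) (use near in \<open>auto elim!: eventually_mono simp: gpos less_imp_le\<close>)
  with pos have "f' b > 0"
    by (simp add: zero_less_mult_iff)
  then obtain d where d: "d > 0" "\<And>h. h > 0 \<Longrightarrow> h < d \<Longrightarrow> f (b - h) < f b"
    using DERIV_pos_inc_left[OF f(1)[of b]] ab by auto
  define h where "h = min (d / 2) ((b - a) / 2)"
  have "h > 0" "h < d" "b - h \<in> {a<..<b}"
    using d(1) ab by (auto simp: h_def min_def field_simps)
  then show False
    using d(2)[of h] fpos[of "b - h"] zeros by simp
qed

text \<open>Multiplying \<open>f\<close> and \<open>g\<close> by their values at the midpoint makes both positive and changes neither
  equation.\<close>

lemma sturm_comparison:
  fixes f g :: "real \<Rightarrow> real"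
  assumes ab: "a < b"
    and f: "\<And>t. t \<in> {a..b} \<Longrightarrow> (f has_real_derivative f' t) (at t)"
           "\<And>t. t \<in> {a..b} \<Longrightarrow> (f' has_real_derivative - Q t * f t) (at t)"
    and g: "\<And>t. t \<in> {a..b} \<Longrightarrow> (g has_real_derivative g' t) (at t)"
           "\<And>t. t \<in> {a..b} \<Longrightarrow> (g' has_real_derivative - R t * g t) (at t)"
    and QR: "\<And>t. t \<in> {a<..<b} \<Longrightarrow> Q t < R t"
    and fnz: "\<And>t. t \<in> {a<..<b} \<Longrightarrow> f t \<noteq> 0"
    and zeros: "f a = 0" "f b = 0" "g a = 0"
  shows "\<exists>t\<in>{a<..<b}. g t = 0"
proof (rule ccontr)
  assume "\<not> (\<exists>t\<in>{a<..<b}. g t = 0)"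
  then have gnz: "\<And>t. t \<in> {a<..<b} \<Longrightarrow> g t \<noteq> 0"
    by blast
  define m where "m = (a + b) / 2"
  have m: "m \<in> {a<..<b}"
    using ab by (auto simp: m_def)
  have cont: "continuous_on {a<..<b} f" "continuous_on {a<..<b} g"
    by (auto intro!: continuous_at_imp_continuous_on DERIV_isCont f g)
  show False
  proof (rule sturm_comparison_pos[OF ab])
    show "((\<lambda>t. f m * f t) has_real_derivative f m * f' t) (at t)" if "t \<in> {a..b}" for t
      using f(1)[OF that] by (rule DERIV_cmult)
    show "((\<lambda>t. f m * f' t) has_real_derivative - Q t * (f m * f t)) (at t)" if "t \<in> {a..b}" for t
      using DERIV_cmult[OF f(2)[OF that], of "f m"] by (simp add: algebra_simps)
    show "((\<lambda>t. g m * g t) has_real_derivative g m * g' t) (at t)" if "t \<in> {a..b}" for t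
      using g(1)[OF that] by (rule DERIV_cmult)
    show "((\<lambda>t. g m * g' t) has_real_derivative - R t * (g m * g t)) (at t)" if "t \<in> {a..b}" for t
      using DERIV_cmult[OF g(2)[OF that], of "g m"] by (simp add: algebra_simps)
  qed (use QR zeros nonvanishing_same_sign[OF cont(1) fnz m] nonvanishing_same_sign[OF cont(2) gnz m]
       in auto)
qed

text \<open>If the right-hand gap \<open>w - v\<close> were not the larger one, the reflection \<open>t \<mapsto> f (2 v - t)\<close> would
  have no zero in \<open>(v, w)\<close>; but its coefficient \<open>Q (2 v - t)\<close> exceeds \<open>Q t\<close> there.\<close>

lemma zeros_convex_of_decreasing_coefficient:
  fixes f :: "real \<Rightarrow> real"
  assumes f: "\<And>t. t \<in> {a<..<b} \<Longrightarrow> (f has_real_derivative f' t) (at t)"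
             "\<And>t. t \<in> {a<..<b} \<Longrightarrow> (f' has_real_derivative - Q t * f t) (at t)"
    and dec: "\<And>s t. \<lbrakk>a < s; s < t; t < b\<rbrakk> \<Longrightarrow> Q t < Q s"
  shows "zeros_convex_on f a b"
  unfolding zeros_convex_on_def
proof (intro allI impI)
  fix u v w
  assume uv: "consecutive_zeros_on f a b u v" and vw: "consecutive_zeros_on f a b v w"
  have ord: "a < u" "u < v" "v < w" "w < b" and zeros: "f u = 0" "f v = 0" "f w = 0"
    using uv vw by (auto simp: consecutive_zeros_on_def zeros_on_def)
  have nz: "f t \<noteq> 0" if "t \<in> {u<..<v} \<or> t \<in> {v<..<w}" for t
    using that
  proof
    assume t: "t \<in> {u<..<v}"
    then have "t \<notin> zeros_on f a b"
      using uv by (auto simp: consecutive_zeros_on_def)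
    then show ?thesis
      using t ord by (auto simp: zeros_on_def)
  next
    assume t: "t \<in> {v<..<w}"
    then have "t \<notin> zeros_on f a b"
      using vw by (auto simp: consecutive_zeros_on_def)
    then show ?thesis
      using t ord by (auto simp: zeros_on_def)
  qed
  show "w - v > v - u"
  proof (rule ccontr)
    assume short: "\<not> w - v > v - u"
    have reflect: "((\<lambda>t. 2 * v - t) has_real_derivative - 1) (at t)" for t
      by (auto intro!: derivative_eq_intros)
    have "\<exists>t\<in>{v<..<w}. f (2 * v - t) = 0"
    proof (rule sturm_comparison)
      show "v < w" by fact
      show "(f has_real_derivative f' t) (at t)" if "t \<in> {v..w}" for t
        using that ord by (intro f) auto
      show "(f' has_real_derivative - Q t * f t) (at t)" if "t \<in> {v..w}" for t
        using that ord by (intro f) auto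
      show "((\<lambda>t. f (2 * v - t)) has_real_derivative - f' (2 * v - t)) (at t)"
        if "t \<in> {v..w}" for t
        using DERIV_chain2[OF f(1) reflect] that ord short by simp
      show "((\<lambda>t. - f' (2 * v - t)) has_real_derivative - Q (2 * v - t) * f (2 * v - t)) (at t)"
        if "t \<in> {v..w}" for t
        using DERIV_minus[OF DERIV_chain2[OF f(2) reflect]] that ord short by simp
      show "Q t < Q (2 * v - t)" if "t \<in> {v<..<w}" for t
        using that ord short by (intro dec) auto
    qed (use zeros nz in auto)
    then show False
      using nz short by force
  qed
qed

section \<open>The differential equation of the Jacobi polynomials\<close>

text \<open>With \<open>A = (t - 1) / 2\<close> and \<open>B = (t + 1) / 2\<close> the coefficients of the equation become
  \<open>1 - t\<^sup>2 = - 4 A B\<close> and \<open>\<beta> - \<alpha> - (\<alpha> + \<beta> + 2) t = - 2 ((\<beta> + 1) A + (\<alpha> + 1) B)\<close>.  Inserting the single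
  term \<open>A\<^sup>s B\<^sup>r\<close>, with \<open>n = s + r\<close>, and using \<open>B - A = 1\<close> once to lower the degree leaves just two
  monomials.\<close>

lemma jacobi_operator_monomial:
  fixes \<alpha> \<beta> t A B :: real and s r :: nat
  defines "A \<equiv> (t - 1) / 2" and "B \<equiv> (t + 1) / 2"
  defines "y \<equiv> A ^ s * B ^ r"
    and "y' \<equiv> (real s * A ^ (s - 1) * B ^ r + A ^ s * (real r * B ^ (r - 1))) / 2"
    and "y'' \<equiv> (real s * (real (s - 1) * A ^ (s - 2)) * B ^ r
               + 2 * (real s * A ^ (s - 1)) * (real r * B ^ (r - 1))
               + A ^ s * (real r * (real (r - 1) * B ^ (r - 2)))) / 4"
  shows "(1 - t\<^sup>2) * y'' + (\<beta> - \<alpha> - (\<alpha> + \<beta> + 2) * t) * y'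
          + real (s + r) * (real (s + r) + \<alpha> + \<beta> + 1) * y
        = real r * (real r + \<beta>) * (A ^ s * B ^ (r - 1)) - real s * (real s + \<alpha>) * (A ^ (s - 1) * B ^ r)"
proof -
  have rel: "t = 2 * A + 1" "B = A + 1"
    by (simp_all add: A_def B_def field_simps)
  define a0 a1 a2 where "a0 = A ^ s" and "a1 = real s * A ^ (s - 1)"
    and "a2 = real s * (real (s - 1) * A ^ (s - 2))"
  define b0 b1 b2 where "b0 = B ^ r" and "b1 = real r * B ^ (r - 1)"
    and "b2 = real r * (real (r - 1) * B ^ (r - 2))"
  \<comment> \<open>Euler's relations for the powers; they also cover the exponents 0 and 1.\<close>
  have euler: "A * a1 = real s * a0" "A * a2 = (real s - 1) * a1"
    "B * b1 = real r * b0" "B * b2 = (real r - 1) * b1"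
    by (cases s; cases "s - 1"; cases r; cases "r - 1";
        simp add: a0_def a1_def a2_def b0_def b1_def b2_def)+
  have y: "y = a0 * b0" and y': "2 * y' = a1 * b0 + a0 * b1"
    and y'': "4 * y'' = a2 * b0 + 2 * a1 * b1 + a0 * b2"
    by (simp_all add: y_def y'_def y''_def a0_def a1_def a2_def b0_def b1_def b2_def)
  have "(1 - t\<^sup>2) * y'' + (\<beta> - \<alpha> - (\<alpha> + \<beta> + 2) * t) * y'
          + real (s + r) * (real (s + r) + \<alpha> + \<beta> + 1) * y
        = (real r + \<beta>) * (a0 * b1) - (real s + \<alpha>) * (a1 * b0)"
  proof -
    have "(1 - t\<^sup>2) * y'' = - A * B * (a2 * b0 + 2 * a1 * b1 + a0 * b2)"
      using y'' rel by algebra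
    also have "\<dots> = - (B * ((real s - 1) * a1 * b0) + 2 * (real s * real r * a0 * b0)
                    + A * ((real r - 1) * a0 * b1))"
      using euler by algebra
    finally have 1: "(1 - t\<^sup>2) * y'' = \<dots>" .
    have 2: "(\<beta> - \<alpha> - (\<alpha> + \<beta> + 2) * t) * y' = - ((\<beta> + 1) * A + (\<alpha> + 1) * B) * (a1 * b0 + a0 * b1)"
      using y' rel by algebra
    show ?thesis
      unfolding 1 2 y of_nat_add using euler rel by algebra
  qed
  then show ?thesis
    by (simp add: a0_def a1_def b0_def b1_def mult_ac)
qed

lemma jacobi_coefficient_ratio:
  fixes \<alpha> \<beta> :: real
  assumes "s < n"
  defines "c \<equiv> \<lambda>s. ((real n + \<alpha>) gchoose (n - s)) * ((real n + \<beta>) gchoose s)"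
  shows "c (Suc s) * (real (Suc s) * (real (Suc s) + \<alpha>)) = c s * (real (n - s) * (real (n - s) + \<beta>))"
proof -
  obtain r where n: "n = Suc (s + r)"
    using assms(1) less_iff_Suc_add by auto
  have step: "real (Suc k) * (a gchoose Suc k) = (a - real k) * (a gchoose k)" for a :: real and k
    using gbinomial_absorb_comp[of a k] gbinomial_absorption[of k a] by simp
  have "real (Suc s) * ((real n + \<beta>) gchoose Suc s) = (real (n - s) + \<beta>) * ((real n + \<beta>) gchoose s)"
    unfolding step by (simp add: n algebra_simps)
  moreover have "real (n - s) * ((real n + \<alpha>) gchoose (n - s))
      = (real (Suc s) + \<alpha>) * ((real n + \<alpha>) gchoose (n - Suc s))"
    using step[of r "real n + \<alpha>"] by (simp add: n algebra_simps)
  ultimately show ?thesis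
    unfolding c_def by algebra
qed

text \<open>The two monomials produced by the \<open>s\<close>-th term are \<open>A\<^sup>s B\<^bsup>n-s-1\<^esup>\<close> and \<open>- A\<^bsup>s-1\<^esup> B\<^bsup>n-s\<^esup>\<close> up to factors, and
  \<open>jacobi_coefficient_ratio\<close> says that the first cancels against the second one of term \<open>s + 1\<close>:
  the sum telescopes to zero.\<close>

lemma jacobi_differential_equation:
  fixes \<alpha> \<beta> :: real
  obtains P' P'' where
    "\<And>t. (jacobi_P n \<alpha> \<beta> has_real_derivative P' t) (at t)"
    "\<And>t. (P' has_real_derivative P'' t) (at t)"
    "\<And>t. (1 - t\<^sup>2) * P'' t + (\<beta> - \<alpha> - (\<alpha> + \<beta> + 2) * t) * P' t
          + real n * (real n + \<alpha> + \<beta> + 1) * jacobi_P n \<alpha> \<beta> t = 0"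
proof -
  define c where "c s = ((real n + \<alpha>) gchoose (n - s)) * ((real n + \<beta>) gchoose s)" for s
  define A B :: "real \<Rightarrow> real" where "A t = (t - 1) / 2" and "B t = (t + 1) / 2" for t
  define y where "y s r t = A t ^ s * B t ^ r" for s r t
  define y' where "y' s r t =
      (real s * A t ^ (s - 1) * B t ^ r + A t ^ s * (real r * B t ^ (r - 1))) / 2" for s r t
  define y'' where "y'' s r t =
      (real s * (real (s - 1) * A t ^ (s - 2)) * B t ^ r
        + 2 * (real s * A t ^ (s - 1)) * (real r * B t ^ (r - 1))
        + A t ^ s * (real r * (real (r - 1) * B t ^ (r - 2)))) / 4" for s r t
  have P: "jacobi_P n \<alpha> \<beta> t = (\<Sum>s=0..n. c s * y s (n - s) t)" for t
    by (simp add: jacobi_P_def c_def y_def A_def B_def mult.assoc)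
  have AB: "(A has_real_derivative 1 / 2) (at t)" "(B has_real_derivative 1 / 2) (at t)" for t
    unfolding A_def B_def by (auto intro!: derivative_eq_intros)
  have dy: "(y s r has_real_derivative y' s r t) (at t)" for s r t
    unfolding y_def y'_def
    by (rule derivative_eq_intros AB refl | simp add: algebra_simps)+
  have dy': "(y' s r has_real_derivative y'' s r t) (at t)" for s r t
    unfolding y'_def y''_def
    by (rule derivative_eq_intros AB refl | simp add: algebra_simps numeral_2_eq_2)+
  show ?thesis
  proof (rule that)
    show "(jacobi_P n \<alpha> \<beta> has_real_derivative (\<Sum>s=0..n. c s * y' s (n - s) t)) (at t)" for t
      unfolding P by (intro DERIV_sum DERIV_cmult dy)
    show "((\<lambda>t. \<Sum>s=0..n. c s * y' s (n - s) t)
            has_real_derivative (\<Sum>s=0..n. c s * y'' s (n - s) t)) (at t)" for t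
      by (intro DERIV_sum DERIV_cmult dy')
    fix t
    \<comment> \<open>For \<open>s = n\<close> and \<open>s = 0\<close> the truncated exponent is harmless: the scalar factor vanishes.\<close>
    define F where "F s = c s * (real (n - s) * (real (n - s) + \<beta>)) * (A t ^ s * B t ^ (n - s - 1))" for s
    define G where "G s = c s * (real s * (real s + \<alpha>)) * (A t ^ (s - 1) * B t ^ (n - s))" for s
    have term_eq: "(1 - t\<^sup>2) * (c s * y'' s (n - s) t)
        + (\<beta> - \<alpha> - (\<alpha> + \<beta> + 2) * t) * (c s * y' s (n - s) t)
        + real n * (real n + \<alpha> + \<beta> + 1) * (c s * y s (n - s) t) = F s - G s" if "s \<le> n" for s
    proof -
      have "(1 - t\<^sup>2) * y'' s (n - s) t + (\<beta> - \<alpha> - (\<alpha> + \<beta> + 2) * t) * y' s (n - s) t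
          + real n * (real n + \<alpha> + \<beta> + 1) * y s (n - s) t
        = real (n - s) * (real (n - s) + \<beta>) * (A t ^ s * B t ^ (n - s - 1))
          - real s * (real s + \<alpha>) * (A t ^ (s - 1) * B t ^ (n - s))"
        using jacobi_operator_monomial[of t s "n - s" \<beta> \<alpha>] that
        by (simp add: y_def y'_def y''_def A_def B_def del: of_nat_diff)
      from arg_cong[OF this, of "\<lambda>u. c s * u"]
      show ?thesis
        by (simp add: F_def G_def algebra_simps del: of_nat_diff)
    qed
    have "G (Suc s) = F s" if "s < n" for s
      using jacobi_coefficient_ratio[OF that, of \<alpha> \<beta>] by (simp add: F_def G_def c_def)
    then have shift: "(\<Sum>s<n. G (Suc s)) = (\<Sum>s<n. F s)"
      by simp
    have "(\<Sum>s=0..n. F s - G s) = (\<Sum>s\<le>n. F s) - (\<Sum>s\<le>n. G s)"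
      by (simp add: sum_subtractf atLeast0AtMost)
    also have "(\<Sum>s\<le>n. F s) = (\<Sum>s<n. F s)"
      by (simp add: lessThan_Suc_atMost[symmetric] F_def)
    also have "(\<Sum>s\<le>n. G s) = (\<Sum>s<n. G (Suc s))"
      by (subst sum.atMost_shift) (simp add: G_def)
    finally have "(\<Sum>s=0..n. F s - G s) = 0"
      using shift by simp
    then show "(1 - t\<^sup>2) * (\<Sum>s=0..n. c s * y'' s (n - s) t)
        + (\<beta> - \<alpha> - (\<alpha> + \<beta> + 2) * t) * (\<Sum>s=0..n. c s * y' s (n - s) t)
        + real n * (real n + \<alpha> + \<beta> + 1) * jacobi_P n \<alpha> \<beta> t = 0"
      unfolding P by (simp add: sum_distrib_left sum.distrib[symmetric] term_eq)
  qed
qed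

section \<open>Normal form and monotonicity of its coefficient\<close>

text \<open>A weight with logarithmic derivative \<open>h\<close>, half the coefficient of \<open>y'\<close>, absorbs the first-order
  term.\<close>

lemma liouville_normal_form:
  fixes y w h q :: "real \<Rightarrow> real"
  assumes w: "(w has_real_derivative h t * w t) (at t)"
    and h: "(h has_real_derivative h' t) (at t)"
    and y: "(y has_real_derivative y' t) (at t)" "(y' has_real_derivative y'' t) (at t)"
    and ode: "y'' t + 2 * h t * y' t + q t * y t = 0"
  shows "((\<lambda>t. w t * y t) has_real_derivative w t * (y' t + h t * y t)) (at t)"
    and "((\<lambda>t. w t * (y' t + h t * y t)) has_real_derivative
           - (q t - h' t - (h t)\<^sup>2) * (w t * y t)) (at t)"
proof -
  show "((\<lambda>t. w t * y t) has_real_derivative w t * (y' t + h t * y t)) (at t)"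
    by (rule derivative_eq_intros w y refl | simp add: algebra_simps)+
  have "((\<lambda>t. w t * (y' t + h t * y t)) has_real_derivative
          w t * (y'' t + 2 * h t * y' t + (h' t + (h t)\<^sup>2) * y t)) (at t)"
    by (rule derivative_eq_intros w h y refl | simp add: algebra_simps power2_eq_square)+
  moreover have "y'' t = - (2 * h t * y' t + q t * y t)"
    using ode by simp
  ultimately show "((\<lambda>t. w t * (y' t + h t * y t)) has_real_derivative
           - (q t - h' t - (h t)\<^sup>2) * (w t * y t)) (at t)"
    by (simp add: algebra_simps)
qed

text \<open>The three parameters are the local data at the singular points \<open>1\<close>, \<open>- 1\<close> and \<open>\<infinity>\<close>: near them the
  coefficient behaves like \<open>- x / (4 (1 - t)\<^sup>2)\<close>, \<open>- y / (4 (1 + t)\<^sup>2)\<close> and \<open>- z / (4 t\<^sup>2)\<close>.\<close>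

definition jacobi_normal_coefficient :: "real \<Rightarrow> real \<Rightarrow> real \<Rightarrow> real \<Rightarrow> real" where
  "jacobi_normal_coefficient x y z t =
     (- x / (1 - t)\<^sup>2 - y / (1 + t)\<^sup>2 + (z - x - y) / (1 - t\<^sup>2)) / 4"

lemma jacobi_normal_form:
  fixes \<alpha> \<beta> :: real and n :: nat
  defines "x \<equiv> \<alpha>\<^sup>2 - 1" and "y \<equiv> \<beta>\<^sup>2 - 1"
    and "z \<equiv> (\<alpha> + \<beta> + 2 * real n) * (\<alpha> + \<beta> + 2 * real n + 2)"
    and "f \<equiv> \<lambda>t. ((1 - t) powr ((\<alpha> + 1) / 2) * (1 + t) powr ((\<beta> + 1) / 2)) * jacobi_P n \<alpha> \<beta> t"
  obtains f' where
    "\<And>t. t \<in> {-1<..<1} \<Longrightarrow> (f has_real_derivative f' t) (at t)"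
    "\<And>t. t \<in> {-1<..<1} \<Longrightarrow> (f' has_real_derivative - jacobi_normal_coefficient x y z t * f t) (at t)"
proof -
  obtain P' P'' where P: "\<And>t. (jacobi_P n \<alpha> \<beta> has_real_derivative P' t) (at t)"
    "\<And>t. (P' has_real_derivative P'' t) (at t)"
    and ode: "\<And>t. (1 - t\<^sup>2) * P'' t + (\<beta> - \<alpha> - (\<alpha> + \<beta> + 2) * t) * P' t
          + real n * (real n + \<alpha> + \<beta> + 1) * jacobi_P n \<alpha> \<beta> t = 0"
    using jacobi_differential_equation by metis
  define a b where "a = (\<alpha> + 1) / 2" and "b = (\<beta> + 1) / 2"
  define w where "w t = (1 - t) powr a * (1 + t) powr b" for t
  define h where "h t = b / (1 + t) - a / (1 - t)" for t
  define h' where "h' t = - b / (1 + t)\<^sup>2 - a / (1 - t)\<^sup>2" for t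
  define q where "q t = real n * (real n + \<alpha> + \<beta> + 1) / (1 - t\<^sup>2)" for t
  have fw: "f = (\<lambda>t. w t * jacobi_P n \<alpha> \<beta> t)"
    by (simp add: f_def w_def a_def b_def)
  have nf: "((\<lambda>t. w t * jacobi_P n \<alpha> \<beta> t) has_real_derivative
               w t * (P' t + h t * jacobi_P n \<alpha> \<beta> t)) (at t)"
           "((\<lambda>t. w t * (P' t + h t * jacobi_P n \<alpha> \<beta> t)) has_real_derivative
               - (q t - h' t - (h t)\<^sup>2) * (w t * jacobi_P n \<alpha> \<beta> t)) (at t)"
       and coeff: "q t - h' t - (h t)\<^sup>2 = jacobi_normal_coefficient x y z t"
       if "t \<in> {-1<..<1}" for t
  proof -
    from that have pos: "1 - t > 0" "1 + t > 0"
      by auto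
    have factor: "1 - t\<^sup>2 = (1 - t) * (1 + t)"
      by (simp add: power2_eq_square algebra_simps)
    have dw: "(w has_real_derivative h t * w t) (at t)"
      unfolding w_def h_def using pos
      by (auto intro!: derivative_eq_intros simp: field_simps powr_diff)
    have dh: "(h has_real_derivative h' t) (at t)"
      unfolding h_def h'_def using pos
      by (auto intro!: derivative_eq_intros simp: power2_eq_square)
    have "2 * h t = (\<beta> - \<alpha> - (\<alpha> + \<beta> + 2) * t) / (1 - t\<^sup>2)"
    proof -
      have "2 * h t * (1 - t\<^sup>2) = 2 * b * (1 - t) - 2 * a * (1 + t)"
        using pos by (simp add: h_def factor divide_simps)
      also have "\<dots> = \<beta> - \<alpha> - (\<alpha> + \<beta> + 2) * t"
        by (simp add: a_def b_def field_simps)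
      finally show ?thesis
        using pos by (simp add: factor eq_divide_eq)
    qed
    then have "P'' t + 2 * h t * P' t + q t * jacobi_P n \<alpha> \<beta> t
        = ((1 - t\<^sup>2) * P'' t + (\<beta> - \<alpha> - (\<alpha> + \<beta> + 2) * t) * P' t
          + real n * (real n + \<alpha> + \<beta> + 1) * jacobi_P n \<alpha> \<beta> t) / (1 - t\<^sup>2)"
      using pos by (simp add: q_def factor add_divide_distrib)
    then have ode': "P'' t + 2 * h t * P' t + q t * jacobi_P n \<alpha> \<beta> t = 0"
      using ode by simp
    show "((\<lambda>t. w t * jacobi_P n \<alpha> \<beta> t) has_real_derivative
             w t * (P' t + h t * jacobi_P n \<alpha> \<beta> t)) (at t)"
         "((\<lambda>t. w t * (P' t + h t * jacobi_P n \<alpha> \<beta> t)) has_real_derivative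
             - (q t - h' t - (h t)\<^sup>2) * (w t * jacobi_P n \<alpha> \<beta> t)) (at t)"
      using liouville_normal_form[where w = w and h = h and h' = h' and y = "jacobi_P n \<alpha> \<beta>"
          and y' = P' and y'' = P'' and q = q and t = t, OF dw dh P ode'] by blast+
    have "q t - h' t - (h t)\<^sup>2 = (b - b\<^sup>2) / (1 + t)\<^sup>2 + (a - a\<^sup>2) / (1 - t)\<^sup>2
        + (real n * (real n + \<alpha> + \<beta> + 1) + 2 * a * b) / (1 - t\<^sup>2)"
      using pos by (simp add: q_def h'_def h_def factor power2_diff power_divide diff_divide_distrib
          add_divide_distrib mult.commute[of "1 + t"] mult.commute[of b])
    also have "b - b\<^sup>2 = - y / 4"
      by (simp add: b_def y_def field_simps power2_eq_square)
    also have "a - a\<^sup>2 = - x / 4"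
      by (simp add: a_def x_def field_simps power2_eq_square)
    also have "real n * (real n + \<alpha> + \<beta> + 1) + 2 * a * b = (z - x - y) / 4"
      by (simp add: a_def b_def x_def y_def z_def field_simps power2_eq_square)
    finally show "q t - h' t - (h t)\<^sup>2 = jacobi_normal_coefficient x y z t"
      by (simp add: jacobi_normal_coefficient_def add_divide_distrib diff_divide_distrib mult.commute)
  qed
  show ?thesis
    by (rule that[of "\<lambda>t. w t * (P' t + h t * jacobi_P n \<alpha> \<beta> t)"])
       (use nf in \<open>simp_all add: fw coeff[symmetric]\<close>)
qed

lemma quadratic_nonzero_same_sign:
  fixes a b c :: real
  assumes "b\<^sup>2 - 4 * a * c < 0"
  shows "a * (a * t\<^sup>2 + b * t + c) > 0"
proof -
  have "4 * (a * (a * t\<^sup>2 + b * t + c)) = (2 * a * t + b)\<^sup>2 - (b\<^sup>2 - 4 * a * c)"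
    by (simp add: power2_eq_square algebra_simps)
  also have "\<dots> > 0"
    using assms zero_le_power2[of "2 * a * t + b"] by linarith
  finally show ?thesis
    by simp
qed

text \<open>The cubic \<open>p\<close> is the numerator of the derivative of the coefficient.  Its own derivative is a
  quadratic with discriminant
  \<open>12 (3 x\<^sup>2 + 3 y\<^sup>2 + z\<^sup>2 - 6 x y - 4 x z - 4 y z)\<close>.  When that is negative, the quadratic has the
  constant sign of its leading coefficient \<open>- 3 z\<close>, so the cubic is monotone and bounded above by
  one of its two endpoint values \<open>8 y\<close> and \<open>- 8 x\<close>.\<close>

lemma jacobi_cubic_negative:
  fixes x y z t :: real
  defines "p \<equiv> \<lambda>t. - x * (1 + t) ^ 3 + y * (1 - t) ^ 3 + (z - x - y) * t * (1 - t\<^sup>2)"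
  assumes D: "12 * (3 * x\<^sup>2 + 3 * y\<^sup>2 + z\<^sup>2 - 6 * x * y - 4 * x * z - 4 * y * z) < 0"
    and "x > 0" "y < 0" and t: "-1 < t" "t < 1"
  shows "p t < 0"
proof -
  define p' where "p' t = (- 3 * z) * t\<^sup>2 + 6 * (y - x) * t + (z - 4 * x - 4 * y)" for t
  have deriv: "(p has_real_derivative p' t) (at t)" for t
    unfolding p_def p'_def
    by (auto intro!: derivative_eq_intros simp: algebra_simps power2_eq_square power3_eq_cube)
  have "(6 * (y - x))\<^sup>2 - 4 * (- 3 * z) * (z - 4 * x - 4 * y) < 0"
    using D by (simp add: power2_eq_square algebra_simps)
  then have sign: "(- 3 * z) * p' t > 0" for t
    unfolding p'_def by (rule quadratic_nonzero_same_sign)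
  have ends: "p (-1) = 8 * y" "p 1 = - 8 * x"
    by (simp_all add: p_def)
  show ?thesis
  proof (cases "z > 0")
    case True
    then have "p' s < 0" for s
      using sign[of s] by (simp add: zero_less_mult_iff mult_less_0_iff)
    then have "p t < p (-1)"
      using DERIV_neg_imp_decreasing[OF t(1)] deriv by blast
    then show ?thesis
      using ends \<open>y < 0\<close> by simp
  next
    case False
    then have "p' s > 0" for s
      using sign[of s] by (simp add: zero_less_mult_iff mult_less_0_iff)
    then have "p t < p 1"
      using DERIV_pos_imp_increasing[OF t(2)] deriv by blast
    then show ?thesis
      using ends \<open>x > 0\<close> by simp
  qed
qed

lemma jacobi_normal_coefficient_decreasing:
  fixes x y z s t :: real
  assumes D: "12 * (3 * x\<^sup>2 + 3 * y\<^sup>2 + z\<^sup>2 - 6 * x * y - 4 * x * z - 4 * y * z) < 0"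
    and xy: "x > 0" "y < 0" and st: "-1 < s" "s < t" "t < 1"
  shows "jacobi_normal_coefficient x y z t < jacobi_normal_coefficient x y z s"
proof (rule DERIV_neg_imp_decreasing[OF st(2)])
  fix r assume "s \<le> r" "r \<le> t"
  then have r: "-1 < r" "r < 1" and pos: "1 - r > 0" "1 + r > 0"
    using st by auto
  have factor: "1 - r\<^sup>2 = (1 - r) * (1 + r)"
    by (simp add: power2_eq_square algebra_simps)
  define Q' where "Q' = (- 2 * x / (1 - r) ^ 3 + 2 * y / (1 + r) ^ 3
                         + 2 * r * (z - x - y) / (1 - r\<^sup>2)\<^sup>2) / 4"
  define p where "p = - x * (1 + r) ^ 3 + y * (1 - r) ^ 3 + (z - x - y) * r * (1 - r\<^sup>2)"
  have nz: "1 - r\<^sup>2 \<noteq> 0"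
    using pos by (simp add: factor)
  have sq: "((\<lambda>r. x / (1 - r)\<^sup>2) has_real_derivative 2 * x / (1 - r) ^ 3) (at r)"
           "((\<lambda>r. y / (1 + r)\<^sup>2) has_real_derivative - 2 * y / (1 + r) ^ 3) (at r)"
    using pos by (auto intro!: derivative_eq_intros simp: divide_simps power2_eq_square power3_eq_cube)
      (simp_all add: algebra_simps)
  have mixed: "((\<lambda>r. (z - x - y) / (1 - r\<^sup>2)) has_real_derivative
                 2 * r * (z - x - y) / (1 - r\<^sup>2)\<^sup>2) (at r)"
    using nz by (auto intro!: derivative_eq_intros simp: power2_eq_square)
  have deriv: "(jacobi_normal_coefficient x y z has_real_derivative Q') (at r)"
    unfolding jacobi_normal_coefficient_def Q'_def
    using DERIV_cdivide[OF DERIV_add[OF DERIV_diff[OF DERIV_minus[OF sq(1)] sq(2)] mixed], of 4]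
    by simp
  have "Q' = p / (2 * (1 - r\<^sup>2) ^ 3)"
    using pos by (simp add: Q'_def p_def factor divide_simps)
      (simp add: algebra_simps power2_eq_square power3_eq_cube)
  moreover have "p < 0"
    unfolding p_def using D xy r by (rule jacobi_cubic_negative)
  ultimately have "Q' < 0"
    using pos by (simp add: factor divide_less_0_iff)
  with deriv show "\<exists>d. (jacobi_normal_coefficient x y z has_real_derivative d) (at r) \<and> d < 0"
    by blast
qed

theorem theorem4p1:
  fixes n :: nat and \<alpha> \<beta> x y z D :: real
  assumes "n > 0"
    and "real n + \<alpha> + \<beta> > 0" and "real n + \<alpha> > 0" and "real n + \<beta> > 0"
    and "x = \<alpha>\<^sup>2 - 1" and "y = \<beta>\<^sup>2 - 1"
    and "z = (\<alpha> + \<beta> + 2 * real n) * (\<alpha> + \<beta> + 2 * real n + 2)"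
    and "D = 12 * (3 * x\<^sup>2 + 3 * y\<^sup>2 + z\<^sup>2 - 6 * x * y - 4 * x * z - 4 * y * z)"
    and "\<bar>\<alpha>\<bar> > 1" and "\<bar>\<beta>\<bar> < 1" and "D < 0"
  shows "zeros_convex_on (jacobi_P n \<alpha> \<beta>) (-1) 1"
proof -
  define w where "w t = (1 - t) powr ((\<alpha> + 1) / 2) * (1 + t) powr ((\<beta> + 1) / 2)" for t
  have xy: "x > 0" "y < 0"
    using one_less_power[OF \<open>\<bar>\<alpha>\<bar> > 1\<close>, of 2] \<open>\<bar>\<beta>\<bar> < 1\<close> assms(5,6)
    by (simp_all add: abs_square_less_1)
  obtain f' where f':
    "\<And>t. t \<in> {-1<..<1} \<Longrightarrow> ((\<lambda>t. w t * jacobi_P n \<alpha> \<beta> t) has_real_derivative f' t) (at t)"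
    "\<And>t. t \<in> {-1<..<1} \<Longrightarrow> (f' has_real_derivative
        - jacobi_normal_coefficient x y z t * (w t * jacobi_P n \<alpha> \<beta> t)) (at t)"
    using jacobi_normal_form[where n = n and \<alpha> = \<alpha> and \<beta> = \<beta>] unfolding w_def assms(5-7) by blast
  have "zeros_convex_on (\<lambda>t. w t * jacobi_P n \<alpha> \<beta> t) (-1) 1"
    using f' jacobi_normal_coefficient_decreasing[OF _ xy] \<open>D < 0\<close> assms(8)
    by (intro zeros_convex_of_decreasing_coefficient) auto
  moreover have "zeros_on (\<lambda>t. w t * jacobi_P n \<alpha> \<beta> t) (-1) 1 = zeros_on (jacobi_P n \<alpha> \<beta>) (-1) 1"
    by (auto simp: zeros_on_def w_def)
  ultimately show ?thesis
    by (simp add: zeros_convex_on_def consecutive_zeros_on_def)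
qed

end
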